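(* There is an absolute constant $C>0$ such that for every convex set $A\subseteq\mathbb{R}$ with $|A|\ge 2$, $$\mathsf{E}(A)\le C\,|A|^{\frac{89}{36}}\log^{\frac12}|A|.$$
   Context: A finite set $A=\{a_1,\dots,a_n\}\subseteq\mathbb{R}$ (with $a_1<\dots<a_n$) is called convex if $a_i-a_{i-1}<a_{i+1}-a_i$ for every $2\le i\le n-1$. $\mathsf{E}(A)=|\{(a,b,c,d)\in A^4: a+b=c+d\}|$ is the additive energy. Logarithms are to base $2$. *)

theory Defs
  imports "HOL-Analysis.Analysis"
begin

(* Named finite_convex_set to keep it apart from the library constant convex,
   which is convexity of subsets of a vector space. *)
definition finite_convex_set :: "real set \<Rightarrow> bool" where
  "finite_convex_set A \<longleftrightarrow>
     finite A \<and>
     (\<exists>a :: nat \<Rightarrow> real.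
        strict_mono_on {1..card A} a \<and> A = a ` {1..card A} \<and>
        (\<forall>i. 2 \<le> i \<and> i < card A \<longrightarrow> a i - a (i - 1) < a (i + 1) - a i))"

definition additive_energy :: "real set \<Rightarrow> nat" where
  "additive_energy A =
     card {(a, b, c, d). a \<in> A \<and> b \<in> A \<and> c \<in> A \<and> d \<in> A \<and> a + b = c + d}"

end

theory Submission
  imports Defs
begin

text \<open>
  Write \<open>n = |A|\<close>, let \<open>r(x)\<close> count the representations of \<open>x\<close> as a difference of elements of \<open>A\<close>, and
  ignore logarithms. A pigeonhole on blocks of ranks shows that at most \<open>O(n |B|\<^sup>2 / t\<^sup>3)\<close> numbers
  have \<open>t\<close> representations in \<open>A + B\<close>. This replaces the Szemeredi-Trotter theorem; it gives \<open>n\<^sup>3\<close> as a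
  bound for the third moment of \<open>r\<close> and \<open>n |B|\<^bsup>3/2\<^esup>\<close> for the energy of \<open>A\<close> and \<open>B\<close>.

  Let \<open>P\<close> be the set where \<open>r \<ge> t\<close>, put \<open>p = |P|\<close>, and join \<open>x, y \<in> A\<close> if \<open>x - y \<in> P\<close>. This graph has at
  least \<open>t p\<close> ordered edges, hence about \<open>(t p)\<^sup>3 / n\<^sup>2\<close> walks of length three. Replacing the middle
  edge by the larger matrix \<open>r(x - y) / t\<close>, which is a Gram matrix, and applying Cauchy-Schwarz bounds \<open>t\<close>
  times the number of walks by \<open>n \<sigma>\<close>, where \<open>\<sigma>\<close> counts paths \<open>x - u - y\<close> with weight \<open>r(x - y)\<close>.
  Conversely \<open>\<sigma>\<^sup>2\<close> is at most the third moment of \<open>r\<close> times the sum \<open>Q\<close> of \<open>r(p - q)\<^sup>2\<close> over \<open>p, q \<in> P\<close>,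
  and the energy bound controls how often \<open>p - q\<close> is a popular difference:
  \<open>Q \<le> n\<^bsup>26/9\<^esup> (p / t)\<^bsup>8/9\<^esup>\<close>. Combined with \<open>p t\<^sup>3 \<le> n\<^sup>3\<close> this yields
  \<open>p t\<^sup>2 \<le> n\<^bsup>143/58\<^esup>\<close>. Summing over \<open>t\<close> gives the energy bound up to a power of the logarithm, which is
  absorbed because \<open>143/58 < 89/36\<close>. The powers 9 and 58 in the estimates clear these denominators.
\<close>

section \<open>Counting representations as sums\<close>

text \<open>The second set is arbitrary because it is later the set of negatives of
  \<open>A\<close>, a set of popular differences, or the negatives of such a set.\<close>

definition rep :: "real set \<Rightarrow> real set \<Rightarrow> real \<Rightarrow> nat" where
  "rep A B x = card {a \<in> A. x - a \<in> B}"

lemma rep_le_card: "finite A \<Longrightarrow> rep A B x \<le> card A"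
  unfolding rep_def by (rule card_mono) auto

lemma sum_over_sumset:
  fixes g :: "real \<Rightarrow> real"
  assumes "finite A" "finite B"
  shows "(\<Sum>a\<in>A. \<Sum>b\<in>B. g (a + b)) =
    (\<Sum>z\<in>(\<lambda>(a, b). a + b) ` (A \<times> B). real (rep A B z) * g z)"
proof -
  have fib: "card {w \<in> A \<times> B. (\<lambda>(a, b). a + b) w = z} = rep A B z" for z
    unfolding rep_def
    by (rule bij_betw_same_card[of fst], rule bij_betw_byWitness[where f' = "\<lambda>a. (a, z - a)"]) auto
  have "(\<Sum>a\<in>A. \<Sum>b\<in>B. g (a + b)) = (\<Sum>w\<in>A \<times> B. g ((\<lambda>(a, b). a + b) w))"
    by (simp add: sum.cartesian_product case_prod_unfold)
  also have "\<dots> = (\<Sum>z\<in>(\<lambda>(a, b). a + b) ` (A \<times> B).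
      \<Sum>w\<in>{w \<in> A \<times> B. (\<lambda>(a, b). a + b) w = z}. g ((\<lambda>(a, b). a + b) w))"
    using assms by (intro sum.image_gen) auto
  also have "\<dots> = (\<Sum>z\<in>(\<lambda>(a, b). a + b) ` (A \<times> B).
      \<Sum>w\<in>{w \<in> A \<times> B. (\<lambda>(a, b). a + b) w = z}. g z)"
    by (intro sum.cong) auto
  finally show ?thesis by (simp only: sum_constant fib)
qed

lemma rep_pos_imp: "rep A B x > 0 \<Longrightarrow> x \<in> (\<lambda>(a, b). a + b) ` (A \<times> B)"
proof -
  assume "rep A B x > 0"
  then obtain a where "a \<in> A" "x - a \<in> B"
    unfolding rep_def by (metis (no_types, lifting) card.empty empty_Collect_eq less_irrefl)
  then show ?thesis by (intro image_eqI[of _ _ "(a, x - a)"]) auto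
qed

lemma finite_rep_ge:
  assumes "finite A" "finite B" "t \<ge> 1"
  shows "finite {x. t \<le> rep A B x}"
  by (rule finite_subset[of _ "(\<lambda>(a, b). a + b) ` (A \<times> B)"])
    (use assms rep_pos_imp in force)+

lemma card_rep_ge_trivial:
  assumes "finite A" "finite B" "t \<ge> 1"
  shows "card {x. t \<le> rep A B x} * t \<le> card A * card B"
proof -
  let ?T = "(\<lambda>(a, b). a + b) ` (A \<times> B)"
  have "real (card {x. t \<le> rep A B x} * t) = (\<Sum>x\<in>{x. t \<le> rep A B x}. real t)" by simp
  also have "\<dots> \<le> (\<Sum>x\<in>{x. t \<le> rep A B x}. real (rep A B x))" by (rule sum_mono) auto
  also have "\<dots> \<le> (\<Sum>x\<in>?T. real (rep A B x))"
    using assms rep_pos_imp by (intro sum_mono2) force+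
  also have "\<dots> = real (card A * card B)"
    using sum_over_sumset[OF assms(1,2), of "\<lambda>_. 1"] by simp
  finally show ?thesis by (simp only: of_nat_le_iff)
qed

section \<open>Few numbers have many representations\<close>

text \<open>Only the least element of each fibre of \<open>\<phi>\<close> is not a repeat, so
  \<open>\<phi>\<close> is injective on the non-repeats.\<close>

lemma card_le_card_add_repeats:
  fixes S :: "'a::linorder set"
  assumes "finite S" "finite V" "\<phi> ` S \<subseteq> V"
  shows "card S \<le> card V + card {j \<in> S. \<exists>i\<in>S. i < j \<and> \<phi> i = \<phi> j}"
proof -
  let ?R = "{j \<in> S. \<exists>i\<in>S. i < j \<and> \<phi> i = \<phi> j}"
  have "inj_on \<phi> (S - ?R)"
  proof (rule inj_onI)
    fix x y assume "x \<in> S - ?R" "y \<in> S - ?R" "\<phi> x = \<phi> y"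
    then show "x = y" by (cases x y rule: linorder_cases) auto
  qed
  then have "card (S - ?R) \<le> card V"
    using assms by (intro card_inj_on_le[of \<phi>]) auto
  moreover have "card S = card (S - ?R) + card ?R"
    using card_Int_Diff[of S ?R] assms(1) by (simp add: Int_absorb1 Collect_conj_eq[symmetric] Int_def cong: conj_cong)
  ultimately show ?thesis by simp
qed

text \<open>A gap of length \<open>h\<close> is a sum of \<open>h\<close> consecutive gaps, and by
  convexity each of these grows when the position moves right.\<close>

lemma convex_seq_gap_less:
  fixes a :: "nat \<Rightarrow> real"
  assumes conv: "\<And>i. 2 \<le> i \<Longrightarrow> i < n \<Longrightarrow> a i - a (i - 1) < a (i + 1) - a i"
    and "1 \<le> i" "i < j" "1 \<le> h" "j + h \<le> n"
  shows "a (i + h) - a i < a (j + h) - a j"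
proof -
  have diff: "a (i + 1) - a i < a (j + 1) - a j" if "1 \<le> i" "i < j" "j + 1 \<le> n" for i j
    using that(2,3)
  proof (induction j)
    case (Suc j)
    have step: "a (Suc j) - a j < a (Suc j + 1) - a (Suc j)"
      using conv[of "Suc j"] Suc.prems that(1) by simp
    show ?case
    proof (cases "i = j")
      case False
      then show ?thesis using Suc.IH Suc.prems step by simp
    qed (use step in simp)
  qed simp
  show ?thesis using assms(4,5)
  proof (induction h rule: nat_induct_at_least)
    case base
    then show ?case using diff[of i j] assms by simp
  next
    case (Suc h)
    then show ?case using diff[of "i + h" "j + h"] assms by simp
  qed
qed

lemma ex_strict_mono_rank:
  fixes B :: "'a::linorder set"
  assumes "finite B"
  obtains \<rho> :: "'a \<Rightarrow> nat" where "strict_mono_on B \<rho>" "\<And>b. b \<in> B \<Longrightarrow> \<rho> b < card B"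
proof
  show "strict_mono_on B (\<lambda>b. card {c \<in> B. c < b})"
    using assms by (intro strict_mono_onI psubset_card_mono) auto
  show "card {c \<in> B. c < b} < card B" if "b \<in> B" for b
    using assms that by (intro psubset_card_mono) auto
qed

text \<open>
  In a representation \<open>x = a + b\<close> the rank of \<open>b\<close> decreases as that of \<open>a\<close> grows. Cut the ranks in
  \<open>A\<close> and \<open>B\<close> into blocks of lengths \<open>h\<close> and \<open>l\<close>. The difference \<open>\<phi>\<close> of the block numbers is then
  monotone along the representations of \<open>x\<close>, so all but \<open>card A div h + card B div l + 1\<close> of them
  share both blocks with an earlier one. By convexity such a coincidence is determined by one
  element of \<open>B\<close> and the two rank gaps.
\<close>
lemma card_rep_ge_blocks:
  assumes A: "finite_convex_set A" and B: "finite B" and t: "t \<ge> 1"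
    and h: "h \<ge> 1" and l: "l \<ge> 1"
  shows "card {x. t \<le> rep A B x} * t
    \<le> card {x. t \<le> rep A B x} * (card A div h + card B div l + 1) + card B * l * h"
proof -
  define n where "n = card A"
  obtain a where mono: "strict_mono_on {1..n} a" and A_eq: "A = a ` {1..n}"
    and conv: "\<And>i. 2 \<le> i \<Longrightarrow> i < n \<Longrightarrow> a i - a (i - 1) < a (i + 1) - a i"
    using A unfolding finite_convex_set_def n_def by blast
  have inj: "inj_on a {1..n}" using mono by (rule strict_mono_on_imp_inj_on)
  obtain \<rho> :: "real \<Rightarrow> nat" where \<rho>: "strict_mono_on B \<rho>" and \<rho>_less: "\<And>b. b \<in> B \<Longrightarrow> \<rho> b < card B"
    using ex_strict_mono_rank[OF B] by blast
  have \<rho>_inj: "inj_on \<rho> B" using \<rho> by (rule strict_mono_on_imp_inj_on)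
  define X where "X = {x. t \<le> rep A B x}"
  have finX: "finite X"
    unfolding X_def using A B t by (intro finite_rep_ge) (auto simp: finite_convex_set_def)
  define S where "S x = {i \<in> {1..n}. x - a i \<in> B}" for x
  have finS: "finite (S x)" for x by (simp add: S_def)
  have card_S: "card (S x) = rep A B x" for x
  proof -
    have "bij_betw a (S x) {a \<in> A. x - a \<in> B}"
      unfolding bij_betw_def
    proof
      show "inj_on a (S x)" using inj by (rule inj_on_subset) (auto simp: S_def)
      show "a ` S x = {a \<in> A. x - a \<in> B}" unfolding A_eq S_def by blast
    qed
    then show ?thesis unfolding rep_def by (rule bij_betw_same_card)
  qed
  define \<phi> where "\<phi> x i = int (i div h) - int (\<rho> (x - a i) div l)" for x i
  define V where "V = {- int (card B div l)..int (n div h)}"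
  have card_V: "card V = n div h + card B div l + 1" by (simp add: V_def)
  define R where "R x = {j \<in> S x. \<exists>i\<in>S x. i < j \<and> \<phi> x i = \<phi> x j}" for x
  have "\<phi> x ` S x \<subseteq> V" for x
  proof
    fix v assume "v \<in> \<phi> x ` S x"
    then obtain i where i: "i \<in> S x" "v = \<phi> x i" by blast
    have "i div h \<le> n div h" "\<rho> (x - a i) div l \<le> card B div l"
      using i \<rho>_less[of "x - a i"] by (auto simp: S_def intro!: div_le_mono)
    then show "v \<in> V" unfolding i(2) V_def \<phi>_def by simp
  qed
  then have *: "card (S x) \<le> card V + card (R x)" for x
    unfolding R_def by (intro card_le_card_add_repeats finS) (auto simp: V_def)
  define Z where "Z = Sigma X R"
  have "\<forall>z\<in>Z. \<exists>i. i \<in> S (fst z) \<and> i < snd z \<and> \<phi> (fst z) i = \<phi> (fst z) (snd z)"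
    unfolding Z_def R_def by auto
  then obtain f where f: "\<And>z. z \<in> Z \<Longrightarrow> f z \<in> S (fst z) \<and> f z < snd z \<and> \<phi> (fst z) (f z) = \<phi> (fst z) (snd z)"
    by metis
  define g where "g z = (fst z - a (snd z), \<rho> (fst z - a (f z)) - \<rho> (fst z - a (snd z)), snd z - f z)" for z
  have facts: "f z \<in> {1..n}" "snd z \<in> {1..n}" "f z < snd z" "fst z - a (f z) \<in> B" "fst z - a (snd z) \<in> B"
      "\<rho> (fst z - a (snd z)) < \<rho> (fst z - a (f z))"
      "snd z div h = f z div h"
      "\<rho> (fst z - a (snd z)) div l = \<rho> (fst z - a (f z)) div l" if "z \<in> Z" for z
  proof -
    show 1: "f z \<in> {1..n}" "f z < snd z" "fst z - a (f z) \<in> B" using f[OF that] by (auto simp: S_def)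
    have "snd z \<in> S (fst z)" using that by (auto simp: Z_def R_def)
    then show 2: "snd z \<in> {1..n}" "fst z - a (snd z) \<in> B" by (auto simp: S_def)
    have "a (f z) < a (snd z)" using 1 2 mono by (auto simp: strict_mono_on_def)
    then show 3: "\<rho> (fst z - a (snd z)) < \<rho> (fst z - a (f z))"
      using 1 2 \<rho> by (auto simp: strict_mono_on_def)
    \<comment> \<open>From \<open>f z\<close> to \<open>snd z\<close> the block number of the index
      cannot fall and that of the partner in \<open>B\<close> cannot rise. Equal differences
      therefore force both to agree.\<close>
    have "f z div h \<le> snd z div h" "\<rho> (fst z - a (snd z)) div l \<le> \<rho> (fst z - a (f z)) div l"
      using 1 3 by (auto intro!: div_le_mono)
    moreover have "\<phi> (fst z) (f z) = \<phi> (fst z) (snd z)" using f[OF that] by blast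
    ultimately show "snd z div h = f z div h"
      "\<rho> (fst z - a (snd z)) div l = \<rho> (fst z - a (f z)) div l"
      unfolding \<phi>_def by linarith+
  qed
  have same_block: "q - p < m" if "p div m = q div m" "m \<ge> 1" for p q m :: nat
  proof -
    have "p = m * (p div m) + p mod m" "q = m * (p div m) + q mod m"
      using that(1) by (metis mult_div_mod_eq)+
    moreover have "q mod m < m" using that(2) by simp
    ultimately show ?thesis by linarith
  qed
  have "g ` Z \<subseteq> B \<times> {..<l} \<times> {..<h}"
    using facts same_block h l unfolding g_def by fastforce
  moreover have "inj_on g Z"
  proof (rule inj_onI)
    fix z w assume z: "z \<in> Z" and w: "w \<in> Z" and eq: "g z = g w"
    have b: "fst z - a (snd z) = fst w - a (snd w)" using eq by (simp add: g_def)
    have "\<rho> (fst z - a (f z)) - \<rho> (fst w - a (snd w)) = \<rho> (fst w - a (f w)) - \<rho> (fst w - a (snd w))"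
      using eq by (simp add: g_def b)
    \<comment> \<open>Subtraction of naturals is truncated; cancelling is sound because the rank of
      the earlier partner is the larger one.\<close>
    then have "\<rho> (fst z - a (f z)) = \<rho> (fst w - a (f w))"
      using facts(6)[OF z, unfolded b] facts(6)[OF w] by linarith
    then have b': "fst z - a (f z) = fst w - a (f w)"
      using \<rho>_inj facts(4)[OF z] facts(4)[OF w] by (auto dest: inj_onD)
    define k where "k = snd z - f z"
    have k: "k \<ge> 1" "snd z = f z + k" "snd w = f w + k"
      using eq facts(3)[OF z] facts(3)[OF w] by (auto simp: g_def k_def)
    \<comment> \<open>The sum \<open>fst z\<close> cancels in the difference of the two elements of
      \<open>B\<close>, which leaves a gap of length \<open>k\<close>. Such gaps strictly increase
      with position, so the gap determines the index.\<close>
    have gap: "a (f z + k) - a (f z) = a (f w + k) - a (f w)"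
      using b b' unfolding k by linarith
    have "f z = f w"
    proof (cases "f z" "f w" rule: linorder_cases)
      case less
      then show ?thesis
        using convex_seq_gap_less[OF conv, of n "f z" "f w" k] facts[OF z] facts[OF w] k gap by auto
    next
      case greater
      then show ?thesis
        using convex_seq_gap_less[OF conv, of n "f w" "f z" k] facts[OF z] facts[OF w] k gap by auto
    qed
    then have "snd z = snd w" using k by simp
    then show "z = w" using b by (simp add: prod_eq_iff)
  qed
  ultimately have "card Z \<le> card (B \<times> {..<l} \<times> {..<h})"
    using B by (intro card_inj_on_le[of g]) auto
  then have card_Z: "card Z \<le> card B * l * h" by (simp add: card_cartesian_product)
  have "finite (R x)" for x unfolding R_def using finS by simp
  then have Z_sum: "card Z = (\<Sum>x\<in>X. card (R x))" unfolding Z_def using finX by (simp add: card_SigmaI)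
  have "card X * t = (\<Sum>x\<in>X. t)" by simp
  also have "\<dots> \<le> (\<Sum>x\<in>X. card V + card (R x))"
    using * card_S unfolding X_def by (intro sum_mono) (metis (mono_tags) le_trans mem_Collect_eq)
  also have "\<dots> = card X * card V + card Z" by (simp add: sum.distrib Z_sum)
  finally show ?thesis using card_Z card_V unfolding X_def n_def by simp
qed

text \<open>The block length exceeds \<open>4 * k / t\<close>, so at most \<open>t / 4\<close> full
  blocks fit into \<open>k\<close>; the \<open>1\<close> added for rounding is absorbed by
  \<open>t \<le> k\<close>.\<close>

lemma block_size:
  fixes k t :: nat
  assumes "1 \<le> t" "t \<le> k"
  shows "real (k div (4 * k div t + 1)) \<le> t / 4" "real (4 * k div t + 1) * t \<le> 5 * k"
proof -
  define h where "h = 4 * k div t + 1"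
  have "4 * k < h * t"
    unfolding h_def using assms(1) dividend_less_times_div[of t "4 * k"] by (simp add: algebra_simps)
  moreover have "k div h * h \<le> k" by simp
  ultimately have "(k div h * h) * 4 \<le> h * t" by linarith
  then have "h * (4 * (k div h)) \<le> h * t" by (simp add: mult.commute mult.left_commute)
  moreover have "h > 0" by (simp add: h_def)
  ultimately have "4 * (k div h) \<le> t" by simp
  then show "real (k div (4 * k div t + 1)) \<le> t / 4" by (simp add: h_def)
  have "4 * k div t * t \<le> 4 * k" by simp
  then have "h * t \<le> 5 * k" unfolding h_def using assms(2) by (simp only: add_mult_distrib)
  then show "real (4 * k div t + 1) * t \<le> 5 * k"
    unfolding h_def by (simp only: of_nat_mult[symmetric] of_nat_le_iff)
qed

text \<open>With both block lengths from \<open>block_size\<close>, at most \<open>3 * t / 4\<close>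
  representations of each number are free of coincidences. The remaining quarter is paid for by the
  \<open>m * l * h\<close> possible coincidences, where \<open>l\<close> and \<open>h\<close> are at
  most \<open>5 * m / t\<close> and \<open>5 * n / t\<close>.\<close>

lemma card_rep_ge:
  assumes A: "finite_convex_set A" and B: "finite B" and t: "t \<ge> 1"
  shows "card {x. t \<le> rep A B x} * t ^ 3 \<le> 100 * card A * card B ^ 2"
proof (cases "{x. t \<le> rep A B x} = {}")
  case False
  define X where "X = {x. t \<le> rep A B x}"
  have finA: "finite A" using A by (simp add: finite_convex_set_def)
  from False obtain x where x: "t \<le> rep A B x" by blast
  have tA: "t \<le> card A" using x rep_le_card[OF finA] le_trans by blast
  have "rep A B x \<le> card B"
    unfolding rep_def using B by (intro card_inj_on_le[of "\<lambda>a. x - a"]) (auto simp: inj_on_def)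
  with x have tB: "t \<le> card B" by simp
  define n m where "n = card A" and "m = card B"
  show ?thesis
  \<comment> \<open>The summand \<open>1\<close> in the number of classes is at most
    \<open>t / 4\<close> only for \<open>t \<ge> 4\<close>; smaller \<open>t\<close> are covered by
    the trivial count.\<close>
  proof (cases "t < 4")
    case True
    have "card X * t ^ 3 = (card X * t) * t ^ 2" by (simp add: power3_eq_cube power2_eq_square)
    also have "\<dots> \<le> (n * m) * 3 ^ 2"
      unfolding X_def n_def m_def using True
      by (intro mult_mono card_rep_ge_trivial finA B t power_mono) auto
    also have "\<dots> \<le> 100 * n * m ^ 2"
      using tB t unfolding m_def[symmetric] power2_eq_square by (cases m) (auto simp: algebra_simps)
    finally show ?thesis unfolding X_def n_def m_def .
  next
    case False
    define h l where "h = 4 * n div t + 1" and "l = 4 * m div t + 1"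
    have nh: "real (n div h) \<le> t / 4" and ht: "real h * t \<le> 5 * n"
      and ml: "real (m div l) \<le> t / 4" and lt: "real l * t \<le> 5 * m"
      using block_size tA tB t unfolding h_def l_def n_def m_def by auto
    have "real (card X) * t \<le> card X * (real (n div h) + m div l + 1) + real m * l * h"
    proof -
      have "h \<ge> 1" "l \<ge> 1" by (simp_all add: h_def l_def)
      then have "real (card X * t) \<le> real (card X * (n div h + m div l + 1) + m * l * h)"
        using card_rep_ge_blocks[OF A B t, of h l, folded X_def n_def m_def] by (simp only: of_nat_le_iff)
      then show ?thesis by (simp add: algebra_simps)
    qed
    also have "\<dots> \<le> card X * (t / 4 + t / 4 + t / 4) + real m * l * h"
      using nh ml False by (intro add_mono mult_left_mono) auto
    finally have "real (card X) * t \<le> 4 * (real m * l * h)" by (simp add: algebra_simps)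
    then have "real (card X) * t * t ^ 2 \<le> 4 * (real m * l * h) * t ^ 2" by (rule mult_right_mono) simp
    also have "\<dots> = 4 * real m * ((real l * t) * (real h * t))" by (simp add: power2_eq_square)
    also have "\<dots> \<le> 4 * real m * ((5 * m) * (5 * n))"
      using mult_mono[OF lt ht] by (intro mult_left_mono) simp_all
    finally have "real (card X * t ^ 3) \<le> real (100 * n * m ^ 2)"
      by (simp add: power2_eq_square power3_eq_cube algebra_simps)
    then show ?thesis unfolding X_def n_def m_def by (simp only: of_nat_le_iff)
  qed
qed simp

section \<open>Moments from level sets\<close>

text \<open>The power \<open>f x ^ k\<close> is at most the sum of \<open>k * t ^ (k - 1)\<close>
  over \<open>t \<le> f x\<close>. After exchanging the sums, level \<open>t\<close> contributes at
  most \<open>k * K / t\<close>, whence the harmonic number.\<close>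

lemma layer_cake_bound:
  fixes f :: "'a \<Rightarrow> nat"
  assumes S: "finite S" and fn: "\<And>x. x \<in> S \<Longrightarrow> f x \<le> n" and k: "k \<ge> 1"
    and level: "\<And>t. 1 \<le> t \<Longrightarrow> t \<le> n \<Longrightarrow> real (card {x \<in> S. t \<le> f x}) * real t ^ k \<le> K"
  shows "(\<Sum>x\<in>S. real (f x) ^ k) \<le> k * K * harm n"
proof -
  have pow: "real m ^ k \<le> (\<Sum>t=1..m. k * real t ^ (k - 1))" for m
  proof (induction m)
    case (Suc m)
    have "real (Suc m) ^ k - real m ^ k \<le> k * real (Suc m) ^ (k - 1)"
    proof -
      have "real (Suc m) ^ k - real m ^ k = (\<Sum>i<k. real (Suc m) ^ i * real m ^ (k - Suc i))"
        using power_diff_sumr2[of "real (Suc m)" k "real m"] 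
        by (simp add: mult.commute)
      also have "\<dots> \<le> (\<Sum>i<k. real (Suc m) ^ (k - 1))"
      proof (rule sum_mono)
        fix i assume "i \<in> {..<k}"
        then have "real (Suc m) ^ (k - 1) = real (Suc m) ^ i * real (Suc m) ^ (k - Suc i)"
          by (simp flip: power_add)
        then show "real (Suc m) ^ i * real m ^ (k - Suc i) \<le> real (Suc m) ^ (k - 1)"
          by (auto intro!: mult_left_mono power_mono)
      qed
      finally show ?thesis by simp
    qed
    with Suc show ?case by simp
  qed (use k in \<open>simp add: power_0_left\<close>)
  have "(\<Sum>x\<in>S. real (f x) ^ k) \<le> (\<Sum>x\<in>S. \<Sum>t=1..f x. k * real t ^ (k - 1))"
    by (intro sum_mono pow)
  also have "\<dots> = (\<Sum>x\<in>S. \<Sum>t=1..n. of_bool (t \<le> f x) * (k * real t ^ (k - 1)))"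
  proof (rule sum.cong[OF refl])
    fix x assume "x \<in> S"
    then show "(\<Sum>t=1..f x. k * real t ^ (k - 1)) =
        (\<Sum>t=1..n. of_bool (t \<le> f x) * (k * real t ^ (k - 1)))"
      using fn[of x] by (intro sum.mono_neutral_cong_left) auto
  qed
  also have "\<dots> = (\<Sum>t=1..n. (\<Sum>x\<in>S. of_bool (t \<le> f x)) * (k * real t ^ (k - 1)))"
    by (subst sum.swap) (simp add: sum_distrib_right)
  also have "\<dots> = (\<Sum>t=1..n. real (card {x \<in> S. t \<le> f x}) * (k * real t ^ (k - 1)))"
    using S by (simp add: Int_def)
  also have "\<dots> \<le> (\<Sum>t=1..n. k * K * inverse t)"
  proof (rule sum_mono)
    fix t assume t: "t \<in> {1..n}"
    have "real t ^ k = real t * real t ^ (k - 1)" using k by (cases k) auto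
    then have "real (card {x \<in> S. t \<le> f x}) * real t ^ (k - 1) \<le> K * inverse t"
      using level[of t] t by (simp add: field_simps)
    then have "k * (real (card {x \<in> S. t \<le> f x}) * real t ^ (k - 1)) \<le> k * (K * inverse t)"
      by (rule mult_left_mono) simp
    then show "real (card {x \<in> S. t \<le> f x}) * (k * real t ^ (k - 1)) \<le> k * K * inverse t"
      by (simp add: mult_ac)
  qed
  finally show ?thesis by (simp add: harm_def sum_distrib_left)
qed

text \<open>This is the previous bound with the \<open>m\<close>-th root of \<open>K\<close>;
  stating it in powers keeps fractional exponents out of later estimates.\<close>

lemma layer_cake_bound_power:
  fixes f :: "'a \<Rightarrow> nat"
  assumes S: "finite S" and fn: "\<And>x. x \<in> S \<Longrightarrow> f x \<le> n" and k: "k \<ge> 1" and m: "m \<ge> 1"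
    and K: "K \<ge> 0"
    and level: "\<And>t. 1 \<le> t \<Longrightarrow> t \<le> n \<Longrightarrow> (real (card {x \<in> S. t \<le> f x}) * real t ^ k) ^ m \<le> K"
  shows "(\<Sum>x\<in>S. real (f x) ^ k) ^ m \<le> (k * harm n) ^ m * K"
proof -
  have "real (card {x \<in> S. t \<le> f x}) * real t ^ k \<le> root m K" if "1 \<le> t" "t \<le> n" for t
  proof -
    have "real (card {x \<in> S. t \<le> f x}) * real t ^ k
        = root m ((real (card {x \<in> S. t \<le> f x}) * real t ^ k) ^ m)"
      using m by (intro real_root_power_cancel[symmetric]) auto
    also have "\<dots> \<le> root m K"
      using level[OF that] m by (intro real_root_le_mono) auto
    finally show ?thesis .
  qed
  then have "(\<Sum>x\<in>S. real (f x) ^ k) \<le> k * root m K * harm n"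
    using S fn k by (intro layer_cake_bound) auto
  then have "(\<Sum>x\<in>S. real (f x) ^ k) ^ m \<le> (k * root m K * harm n) ^ m"
    by (intro power_mono sum_nonneg) auto
  also have "\<dots> = (k * harm n) ^ m * K"
    using m K by (simp add: power_mult_distrib mult_ac)
  finally show ?thesis .
qed

text \<open>If \<open>N\<close> numbers have at least \<open>t\<close> representations, then
  \<open>(N * t ^ 2) ^ 2\<close> is the product of \<open>N * t\<close> and
  \<open>N * t ^ 3\<close>, bounded by the trivial count and by \<open>card_rep_ge\<close>. Hence
  the square on the left.\<close>

lemma rep_energy_bound:
  assumes A: "finite_convex_set A" and B: "finite B" and T: "finite T"
  shows "(\<Sum>x\<in>T. real (rep A B x) ^ 2) ^ 2 \<le> 400 * harm (card A) ^ 2 * real (card A) ^ 2 * real (card B) ^ 3"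
proof -
  have finA: "finite A" using A by (simp add: finite_convex_set_def)
  have "(\<Sum>x\<in>T. real (rep A B x) ^ 2) ^ 2 \<le>
    (real 2 * harm (card A)) ^ 2 * (100 * real (card A) ^ 2 * real (card B) ^ 3)"
  proof (rule layer_cake_bound_power)
    fix t :: nat assume t: "1 \<le> t"
    define N where "N = real (card {x. t \<le> rep A B x})"
    have "card {x \<in> T. t \<le> rep A B x} \<le> card {x. t \<le> rep A B x}"
      by (intro card_mono finite_rep_ge finA B t) auto
    then have "(real (card {x \<in> T. t \<le> rep A B x}) * real t ^ 2) ^ 2 \<le> (N * real t ^ 2) ^ 2"
      unfolding N_def by (intro power_mono mult_right_mono) auto
    also have "\<dots> = (N * real t) * (N * real t ^ 3)"
      by (simp add: power2_eq_square power3_eq_cube mult_ac)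
    also have "\<dots> \<le> real (card A * card B) * real (100 * card A * card B ^ 2)"
    proof (intro mult_mono)
      show "N * real t \<le> real (card A * card B)"
        using card_rep_ge_trivial[OF finA B t] unfolding N_def
        by (simp only: of_nat_mult[symmetric] of_nat_le_iff)
      show "N * real t ^ 3 \<le> real (100 * card A * card B ^ 2)"
        using card_rep_ge[OF A B t] unfolding N_def
        by (simp only: of_nat_mult[symmetric] of_nat_power[symmetric] of_nat_le_iff)
    qed (auto simp: N_def)
    also have "\<dots> = 100 * real (card A) ^ 2 * real (card B) ^ 3"
      by (simp add: power2_eq_square power3_eq_cube mult_ac)
    finally show "(real (card {x \<in> T. t \<le> rep A B x}) * real t ^ 2) ^ 2 \<le> \<dots>" .
  qed (use T rep_le_card[OF finA] in auto)
  then show ?thesis by (simp add: power_mult_distrib)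
qed

section \<open>Differences of a convex set\<close>

text \<open>This is the function \<open>r\<close> of the overview.\<close>

definition diff_count :: "real set \<Rightarrow> real \<Rightarrow> nat" where
  "diff_count A x = card {a \<in> A. a - x \<in> A}"

lemma diff_count_eq_rep: "diff_count A x = rep A (uminus ` A) x"
proof -
  have "x - a \<in> uminus ` A \<longleftrightarrow> a - x \<in> A" for a
    using inj_image_mem_iff[of uminus "a - x" A] by simp
  then show ?thesis by (simp add: diff_count_def rep_def)
qed

lemma diff_count_minus: "diff_count A (- x) = diff_count A x"
  unfolding diff_count_def
  by (rule bij_betw_same_card[of "\<lambda>a. a + x"], rule bij_betw_byWitness[where f' = "\<lambda>a. a - x"]) auto

lemma diff_count_le: "finite A \<Longrightarrow> diff_count A x \<le> card A"
  by (simp add: diff_count_eq_rep rep_le_card)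

lemma finite_diff_count_ge: "finite A \<Longrightarrow> t \<ge> 1 \<Longrightarrow> finite {x. t \<le> diff_count A x}"
  by (simp add: diff_count_eq_rep finite_rep_ge)

lemma card_diff_count_ge:
  assumes "finite_convex_set A" "t \<ge> 1"
  shows "real (card {x. t \<le> diff_count A x}) * real t ^ 3 \<le> 100 * real (card A) ^ 3"
proof -
  have "finite (uminus ` A)" using assms by (simp add: finite_convex_set_def)
  then have "card {x. t \<le> diff_count A x} * t ^ 3 \<le> 100 * card A ^ 3"
    using card_rep_ge[OF assms(1) _ assms(2), of "uminus ` A"]
    by (simp add: diff_count_eq_rep card_image power2_eq_square power3_eq_cube mult_ac)
  then have "real (card {x. t \<le> diff_count A x} * t ^ 3) \<le> real (100 * card A ^ 3)"
    by (simp only: of_nat_le_iff)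
  then show ?thesis by simp
qed

lemma third_moment_bound:
  assumes A: "finite_convex_set A" and T: "finite T"
  shows "(\<Sum>x\<in>T. real (diff_count A x) ^ 3) \<le> 300 * harm (card A) * real (card A) ^ 3"
proof -
  have finA: "finite A" using A by (simp add: finite_convex_set_def)
  have "(\<Sum>x\<in>T. real (diff_count A x) ^ 3) \<le> real 3 * (100 * real (card A) ^ 3) * harm (card A)"
  proof (rule layer_cake_bound)
    fix t :: nat assume t: "1 \<le> t"
    have "card {x \<in> T. t \<le> diff_count A x} \<le> card {x. t \<le> diff_count A x}"
      by (intro card_mono finite_diff_count_ge finA t) auto
    then have "real (card {x \<in> T. t \<le> diff_count A x}) * real t ^ 3 \<le> real (card {x. t \<le> diff_count A x}) * real t ^ 3"
      by (intro mult_right_mono) auto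
    with card_diff_count_ge[OF A t]
    show "real (card {x \<in> T. t \<le> diff_count A x}) * real t ^ 3 \<le> 100 * real (card A) ^ 3" by simp
  qed (use T diff_count_le[OF finA] in auto)
  then show ?thesis by (simp add: mult_ac)
qed

section \<open>Differences between popular differences\<close>

lemma card_Collect_eq_sum_of_bool:
  "finite S \<Longrightarrow> real (card {x \<in> S. Q x}) = (\<Sum>x\<in>S. of_bool (Q x))"
  by (simp add: Int_def)

text \<open>For each pair with \<open>p - q \<in> X\<close> at least \<open>t\<close> elements
  \<open>a\<close> of \<open>A\<close> satisfy \<open>a + p \<in> A\<close>. Then
  \<open>a + q = (a + p) - (p - q)\<close> is a sum in \<open>A + P\<close> and also in
  \<open>A - X\<close>, so Cauchy-Schwarz reduces the count to two energies.\<close>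

lemma popular_difference_pairs:
  assumes A: "finite_convex_set A" and P: "finite P" and X: "finite X"
    and pop: "\<And>p. p \<in> P \<Longrightarrow> t \<le> diff_count A p"
  defines "N \<equiv> real (card {w \<in> P \<times> P. fst w - snd w \<in> X})"
  shows "(N * real t) ^ 4 \<le> 160000 * harm (card A) ^ 4 * real (card A) ^ 4 * real (card P) ^ 3 * real (card X) ^ 3"
proof -
  have finA: "finite A" using A by (simp add: finite_convex_set_def)
  let ?T = "(\<lambda>(a, b). a + b) ` (A \<times> P)"
  let ?Y = "uminus ` X"
  have N_eq: "N = (\<Sum>p\<in>P. \<Sum>q\<in>P. of_bool (p - q \<in> X))"
    unfolding N_def using P by (simp add: card_Collect_eq_sum_of_bool sum.cartesian_product case_prod_unfold del: sum_of_bool_eq)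
  have shift: "(\<Sum>p\<in>P. of_bool (p - q \<in> X) * of_bool (a + p \<in> A)) \<le> real (rep A ?Y (a + q))" for a q
  proof -
    have "card {p \<in> P. p - q \<in> X \<and> a + p \<in> A} \<le> card {c \<in> A. a + q - c \<in> ?Y}"
    proof (rule card_inj_on_le[of "\<lambda>p. a + p"])
      show "(\<lambda>p. a + p) ` {p \<in> P. p - q \<in> X \<and> a + p \<in> A} \<subseteq> {c \<in> A. a + q - c \<in> ?Y}"
        by (auto intro!: image_eqI[of _ uminus])
    qed (use finA in auto)
    then show ?thesis
      unfolding rep_def using card_Collect_eq_sum_of_bool[OF P, of "\<lambda>p. p - q \<in> X \<and> a + p \<in> A"]
      by (simp only: of_bool_conj of_nat_le_iff flip: of_nat_le_iff[where 'a = real])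
  qed
  have dc: "real (diff_count A p) = (\<Sum>a\<in>A. of_bool (a + p \<in> A))" for p
    using card_Collect_eq_sum_of_bool[OF finA, of "\<lambda>a. a + p \<in> A"] diff_count_minus[of A p]
    unfolding diff_count_def by simp
  have "N * real t = (\<Sum>p\<in>P. \<Sum>q\<in>P. of_bool (p - q \<in> X) * real t)"
    unfolding N_eq by (simp only: sum_distrib_right)
  also have "\<dots> \<le> (\<Sum>p\<in>P. \<Sum>q\<in>P. of_bool (p - q \<in> X) * (\<Sum>a\<in>A. of_bool (a + p \<in> A)))"
    using pop by (intro sum_mono mult_left_mono) (simp_all only: dc[symmetric] of_nat_le_iff, simp)
  also have "\<dots> = (\<Sum>a\<in>A. \<Sum>q\<in>P. \<Sum>p\<in>P. of_bool (p - q \<in> X) * of_bool (a + p \<in> A))"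
    unfolding sum_distrib_left by (subst sum.swap[of _ A], subst sum.swap[of _ P P], subst sum.swap[of _ A P]) (rule refl)
  also have "\<dots> \<le> (\<Sum>a\<in>A. \<Sum>q\<in>P. real (rep A ?Y (a + q)))"
    by (intro sum_mono shift)
  also have "\<dots> = (\<Sum>z\<in>?T. real (rep A P z) * real (rep A ?Y z))"
    by (rule sum_over_sumset[OF finA P])
  finally have Nt: "N * real t \<le> (\<Sum>z\<in>?T. real (rep A P z) * real (rep A ?Y z))" .
  have "(N * real t) ^ 4 = ((N * real t) ^ 2) ^ 2" by simp
  also have "\<dots> \<le> ((\<Sum>z\<in>?T. real (rep A P z) * real (rep A ?Y z)) ^ 2) ^ 2"
    using Nt by (intro power_mono) (auto simp: N_def)
  also have "\<dots> \<le> ((\<Sum>z\<in>?T. real (rep A P z) ^ 2) * (\<Sum>z\<in>?T. real (rep A ?Y z) ^ 2)) ^ 2"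
    by (intro power_mono Cauchy_Schwarz_ineq_sum) auto
  also have "\<dots> = (\<Sum>z\<in>?T. real (rep A P z) ^ 2) ^ 2 * (\<Sum>z\<in>?T. real (rep A ?Y z) ^ 2) ^ 2"
    by (simp only: power_mult_distrib)
  also have "\<dots> \<le> (400 * harm (card A) ^ 2 * real (card A) ^ 2 * real (card P) ^ 3)
      * (400 * harm (card A) ^ 2 * real (card A) ^ 2 * real (card ?Y) ^ 3)"
    using finA P X harm_nonneg by (intro mult_mono rep_energy_bound A) auto
  also have "card ?Y = card X" by (simp add: card_image)
  finally show ?thesis by (simp add: mult_ac power2_eq_square power4_eq_xxxx power3_eq_cube)
qed

definition popular :: "real set \<Rightarrow> nat \<Rightarrow> real set" where
  "popular A t = {x. t \<le> diff_count A x}"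

text \<open>
  The bound on \<open>N * s\<^sup>2\<close> is the geometric mean, with weights 1/9 and 8/9, of the trivial bound
  \<open>N \<le> (card P)\<^sup>2\<close> and of \<open>popular_difference_pairs\<close>.
\<close>
lemma popular_difference_level:
  assumes A: "finite_convex_set A" and t: "t \<ge> 1" and s: "s \<ge> 1"
  defines "P \<equiv> popular A t"
  defines "N \<equiv> real (card {w \<in> P \<times> P. fst w - snd w \<in> popular A s})"
  shows "(N * real s ^ 2) ^ 9 * real t ^ 8
    \<le> 160000000000 ^ 2 * harm (card A) ^ 8 * real (card A) ^ 26 * real (card P) ^ 8"
proof -
  define n H p x where "n = real (card A)" and "H = (harm (card A) :: real)"
    and "p = real (card P)" and "x = real (card (popular A s))"
  have nonneg: "n \<ge> 0" "H \<ge> 0" "p \<ge> 0" "x \<ge> 0" "N \<ge> 0"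
    by (simp_all add: n_def H_def p_def x_def N_def harm_nonneg)
  have finA: "finite A" using A by (simp add: finite_convex_set_def)
  have finP: "finite P" unfolding P_def popular_def by (intro finite_diff_count_ge finA t)
  have "(N * real t) ^ 4 \<le> 160000 * H ^ 4 * n ^ 4 * p ^ 3 * x ^ 3"
    unfolding N_def H_def n_def p_def x_def
    by (rule popular_difference_pairs[OF A finP])
      (use finite_diff_count_ge[OF finA s] in \<open>auto simp: P_def popular_def\<close>)
  \<comment> \<open>The factor \<open>s ^ 9\<close> turns \<open>x ^ 3\<close> into
    \<open>(x * s ^ 3) ^ 3\<close>, which the bound for the number of \<open>s\<close>-popular
    differences controls.\<close>
  then have "(N * real t) ^ 4 * real s ^ 9 \<le> 160000 * H ^ 4 * n ^ 4 * p ^ 3 * x ^ 3 * real s ^ 9"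
    by (rule mult_right_mono) simp
  also have "\<dots> = 160000 * H ^ 4 * n ^ 4 * p ^ 3 * (x * real s ^ 3) ^ 3"
    by (simp add: power_mult_distrib mult_ac)
  also have "\<dots> \<le> 160000 * H ^ 4 * n ^ 4 * p ^ 3 * (100 * n ^ 3) ^ 3"
    using card_diff_count_ge[OF A s] nonneg unfolding x_def n_def popular_def
    by (intro mult_left_mono power_mono) auto
  also have "\<dots> = 160000000000 * (H ^ 4 * n ^ 13 * p ^ 3)"
    by (simp add: power_mult_distrib mult_ac flip: power_mult power_add)
  finally have *: "(N * real t) ^ 4 * real s ^ 9 \<le> 160000000000 * (H ^ 4 * n ^ 13 * p ^ 3)" .
  have "card {w \<in> P \<times> P. fst w - snd w \<in> popular A s} \<le> card (P \<times> P)"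
    using finP by (intro card_mono) auto
  then have "N \<le> real (card P * card P)" unfolding N_def card_cartesian_product by (simp only: of_nat_le_iff)
  then have Np: "N \<le> p ^ 2" by (simp add: p_def power2_eq_square)
  have "(N * real s ^ 2) ^ 9 * real t ^ 8 = N * ((N * real t) ^ 4 * real s ^ 9) ^ 2"
    by (simp add: power_mult_distrib mult_ac flip: power_mult power_Suc)
  also have "\<dots> \<le> p ^ 2 * (160000000000 * (H ^ 4 * n ^ 13 * p ^ 3)) ^ 2"
    using nonneg by (intro mult_mono power_mono Np *) auto
  also have "\<dots> = 160000000000 ^ 2 * H ^ 8 * n ^ 26 * p ^ 8"
    by (simp add: power_mult_distrib mult_ac flip: power_mult power_add)
  finally show ?thesis unfolding n_def H_def p_def .
qed

text \<open>This is the bound on the sum \<open>Q\<close> of the overview. The level bounds are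
  uniform in \<open>s\<close>, so summing them costs only a constant and nine more harmonic
  factors.\<close>

lemma popular_difference_second_moment:
  assumes A: "finite_convex_set A" and t: "t \<ge> 1"
  defines "P \<equiv> popular A t"
  shows "(\<Sum>w\<in>P \<times> P. real (diff_count A (fst w - snd w)) ^ 2) ^ 9 * real t ^ 8
    \<le> 2 ^ 9 * 160000000000 ^ 2 * harm (card A) ^ 17 * real (card A) ^ 26 * real (card P) ^ 8"
proof -
  have finA: "finite A" using A by (simp add: finite_convex_set_def)
  have finP: "finite P" unfolding P_def popular_def by (intro finite_diff_count_ge finA t)
  let ?K = "160000000000 ^ 2 * harm (card A) ^ 8 * real (card A) ^ 26 * real (card P) ^ 8"
  have "(\<Sum>w\<in>P \<times> P. real (diff_count A (fst w - snd w)) ^ 2) ^ 9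
    \<le> (real 2 * harm (card A)) ^ 9 * (?K / real t ^ 8)"
  proof (rule layer_cake_bound_power)
    fix s :: nat assume "1 \<le> s"
    then show "(real (card {w \<in> P \<times> P. s \<le> diff_count A (fst w - snd w)}) * real s ^ 2) ^ 9 \<le> ?K / real t ^ 8"
      using popular_difference_level[OF A t, of s] t
      by (simp add: pos_le_divide_eq P_def popular_def)
  qed (use finP diff_count_le[OF finA] in \<open>auto intro!: divide_nonneg_nonneg mult_nonneg_nonneg simp: harm_nonneg\<close>)
  then have "(\<Sum>w\<in>P \<times> P. real (diff_count A (fst w - snd w)) ^ 2) ^ 9 * real t ^ 8
    \<le> (real 2 * harm (card A)) ^ 9 * (?K / real t ^ 8) * real t ^ 8"
    by (rule mult_right_mono) simp
  also have "\<dots> = (real 2 * harm (card A)) ^ 9 * ?K" using t by simp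
  also have "\<dots> = 2 ^ 9 * 160000000000 ^ 2 * harm (card A) ^ 17 * real (card A) ^ 26 * real (card P) ^ 8"
    by (simp add: power_mult_distrib mult_ac flip: power_mult power_add)
  finally show ?thesis .
qed

section \<open>Walks and paths in the graph of popular differences\<close>

text \<open>Discarding the vertices of degree less than a quarter of the average keeps half of the edges.\<close>
lemma three_step_walks_lower:
  fixes M :: "'a \<Rightarrow> 'a \<Rightarrow> real"
  assumes fin: "finite A" and nonneg: "\<And>x y. 0 \<le> M x y" and sym: "\<And>x y. M x y = M y x"
  defines "d \<equiv> \<lambda>x. \<Sum>y\<in>A. M x y"
  defines "m \<equiv> \<Sum>x\<in>A. d x"
  shows "m ^ 3 \<le> 32 * real (card A) ^ 2 * (\<Sum>x\<in>A. \<Sum>y\<in>A. M x y * (d x * d y))"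
proof (cases "A = {}")
  case False
  define n where "n = real (card A)"
  have n: "n > 0" using fin False by (simp add: n_def card_gt_0_iff)
  have d_nonneg: "d x \<ge> 0" for x unfolding d_def by (intro sum_nonneg nonneg)
  have m_nonneg: "m \<ge> 0" unfolding m_def by (intro sum_nonneg d_nonneg)
  define \<delta> where "\<delta> = m / (4 * n)"
  have \<delta>: "\<delta> \<ge> 0" unfolding \<delta>_def using n m_nonneg by simp
  define lo :: "'a \<Rightarrow> real" where "lo x = (if d x < \<delta> then 1 else 0)" for x
  have low: "(\<Sum>x\<in>A. lo x * d x) \<le> n * \<delta>"
    using sum_bounded_above[of A "\<lambda>x. lo x * d x" \<delta>] \<delta> by (simp add: n_def lo_def)
  \<comment> \<open>Low vertices cost at most \<open>2 * n * \<delta>\<close>, which is half of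
    \<open>m\<close>; together with \<open>\<delta> ^ 2 = m ^ 2 / (16 * n ^ 2)\<close> this gives
    the constant 32.\<close>
  have "m ^ 3 / (32 * n ^ 2) = \<delta> ^ 2 * (m - 2 * (n * \<delta>))"
    unfolding \<delta>_def using n by (simp add: field_simps power2_eq_square power3_eq_cube)
  also have "\<dots> \<le> \<delta> ^ 2 * (m - (\<Sum>x\<in>A. lo x * d x) - (\<Sum>x\<in>A. lo x * d x))"
    using low by (intro mult_left_mono) auto
  \<comment> \<open>The expression \<open>1 - lo x - lo y\<close> is a linear lower bound for the
    indicator that neither endpoint is low.\<close>
  also have "\<dots> = (\<Sum>x\<in>A. \<Sum>y\<in>A. M x y * (\<delta> ^ 2 * (1 - lo x - lo y)))"
  proof -
    have 1: "(\<Sum>x\<in>A. \<Sum>y\<in>A. M x y * lo x) = (\<Sum>x\<in>A. lo x * d x)"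
      by (simp add: d_def sum_distrib_left mult.commute)
    have 2: "(\<Sum>x\<in>A. \<Sum>y\<in>A. M x y * lo y) = (\<Sum>x\<in>A. lo x * d x)"
      unfolding 1[symmetric] by (subst sum.swap) (simp add: sym)
    have "(\<Sum>x\<in>A. \<Sum>y\<in>A. M x y * (\<delta> ^ 2 * (1 - lo x - lo y)))
      = \<delta> ^ 2 * ((\<Sum>x\<in>A. \<Sum>y\<in>A. M x y) - (\<Sum>x\<in>A. \<Sum>y\<in>A. M x y * lo x) - (\<Sum>x\<in>A. \<Sum>y\<in>A. M x y * lo y))"
    proof -
      have "M x y * (\<delta> ^ 2 * (1 - lo x - lo y)) = \<delta> ^ 2 * (M x y - M x y * lo x - M x y * lo y)" for x y
        by (simp add: algebra_simps)
      then show ?thesis by (simp only: sum_distrib_left[symmetric] sum_subtractf)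
    qed
    then show ?thesis unfolding 1 2 m_def d_def by simp
  qed
  also have "\<dots> \<le> (\<Sum>x\<in>A. \<Sum>y\<in>A. M x y * (d x * d y))"
  proof (intro sum_mono mult_left_mono nonneg)
    fix x y
    show "\<delta> ^ 2 * (1 - lo x - lo y) \<le> d x * d y"
    proof (cases "d x < \<delta> \<or> d y < \<delta>")
      case True
      then have "1 - lo x - lo y \<le> 0" by (auto simp: lo_def)
      then have "\<delta> ^ 2 * (1 - lo x - lo y) \<le> 0" by (simp add: mult_nonneg_nonpos)
      also have "0 \<le> d x * d y" by (simp add: d_nonneg)
      finally show ?thesis .
    next
      case False
      then show ?thesis using \<delta> d_nonneg by (auto simp: lo_def power2_eq_square intro!: mult_mono)
    qed
  qed
  finally show ?thesis using n unfolding n_def by (simp add: field_simps)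
qed (simp add: m_def)

text \<open>The difference set is written as a sumset with the negatives of \<open>A\<close>, to
  match \<open>sum_over_sumset\<close>.\<close>

abbreviation differences :: "real set \<Rightarrow> real set" where
  "differences A \<equiv> (\<lambda>(a, b). a + b) ` (A \<times> uminus ` A)"

text \<open>Via \<open>c = x - a\<close>, the count \<open>diff_count A (x - y)\<close> is the
  number of \<open>c\<close> with both \<open>x - c\<close> and \<open>y - c\<close> in
  \<open>A\<close>. It is thus an inner product of indicator vectors, and its quadratic form is a
  sum of squares.\<close>

lemma diff_count_gram:
  fixes w :: "real \<Rightarrow> real"
  assumes fin: "finite A"
  shows "(\<Sum>c\<in>differences A. (\<Sum>x\<in>A. of_bool (x - c \<in> A) * w x) ^ 2)
    = (\<Sum>x\<in>A. \<Sum>y\<in>A. real (diff_count A (x - y)) * (w x * w y))"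
proof -
  have gram: "real (diff_count A (x - y)) = (\<Sum>c\<in>differences A. of_bool (x - c \<in> A) * of_bool (y - c \<in> A))"
    if "x \<in> A" for x y
  proof -
    have "diff_count A (x - y) = card {c \<in> differences A. x - c \<in> A \<and> y - c \<in> A}"
      unfolding diff_count_def
    proof (rule bij_betw_same_card[of "\<lambda>a. x - a"], rule bij_betw_byWitness[where f' = "\<lambda>c. x - c"])
      show "(\<lambda>a. x - a) ` {a \<in> A. a - (x - y) \<in> A} \<subseteq> {c \<in> differences A. x - c \<in> A \<and> y - c \<in> A}"
      proof
        fix c assume "c \<in> (\<lambda>a. x - a) ` {a \<in> A. a - (x - y) \<in> A}"
        then obtain a where a: "a \<in> A" "a - (x - y) \<in> A" "c = x - a" by blast
        have "(x, - a) \<in> A \<times> uminus ` A" using a that by simp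
        then have "c \<in> differences A" unfolding a(3) by (rule rev_image_eqI) simp
        moreover have "y - c = a - (x - y)" "x - c = a" using a by simp_all
        ultimately show "c \<in> {c \<in> differences A. x - c \<in> A \<and> y - c \<in> A}"
          using a(1,2) by (simp only: mem_Collect_eq)
      qed
      show "(\<lambda>c. x - c) ` {c \<in> differences A. x - c \<in> A \<and> y - c \<in> A} \<subseteq> {a \<in> A. a - (x - y) \<in> A}"
        by (auto simp: algebra_simps)
    qed auto
    then show ?thesis
      using card_Collect_eq_sum_of_bool[of "differences A" "\<lambda>c. x - c \<in> A \<and> y - c \<in> A"] fin
      by (simp only: of_bool_conj finite_imageI finite_cartesian_product)
  qed
  have "(\<Sum>c\<in>differences A. (\<Sum>x\<in>A. of_bool (x - c \<in> A) * w x) ^ 2)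
    = (\<Sum>c\<in>differences A. \<Sum>x\<in>A. \<Sum>y\<in>A. (of_bool (x - c \<in> A) * of_bool (y - c \<in> A)) * (w x * w y))"
    by (simp only: power2_eq_square sum_product mult_ac)
  also have "\<dots> = (\<Sum>x\<in>A. \<Sum>y\<in>A. (\<Sum>c\<in>differences A. of_bool (x - c \<in> A) * of_bool (y - c \<in> A)) * (w x * w y))"
    unfolding sum_distrib_right by (subst sum.swap, rule sum.cong[OF refl], rule sum.swap)
  also have "\<dots> = (\<Sum>x\<in>A. \<Sum>y\<in>A. real (diff_count A (x - y)) * (w x * w y))"
    by (intro sum.cong refl) (simp only: gram)
  finally show ?thesis .
qed

lemma sum_translate:
  fixes f :: "real \<Rightarrow> real"
  assumes "finite A" "finite P"
  shows "(\<Sum>x\<in>A. of_bool (x - u \<in> P) * f x) = (\<Sum>p\<in>P. of_bool (u + p \<in> A) * f (u + p))"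
proof -
  have "(\<Sum>x\<in>A. of_bool (x - u \<in> P) * f x) = (\<Sum>x\<in>{x \<in> A. x - u \<in> P}. f x)"
    using assms by (intro sum.mono_neutral_cong_right) auto
  also have "\<dots> = (\<Sum>p\<in>{p \<in> P. u + p \<in> A}. f (u + p))"
    by (rule sum.reindex_bij_witness[of _ "\<lambda>p. u + p" "\<lambda>x. x - u"]) auto
  also have "\<dots> = (\<Sum>p\<in>P. of_bool (u + p \<in> A) * f (u + p))"
    using assms by (intro sum.mono_neutral_cong_left) auto
  finally show ?thesis .
qed

text \<open>This is the weighted path count \<open>\<sigma>\<close>.\<close>
definition cherries :: "real set \<Rightarrow> real set \<Rightarrow> real" where
  "cherries A P = (\<Sum>u\<in>A. \<Sum>x\<in>A. \<Sum>y\<in>A.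
     real (diff_count A (x - y)) * (of_bool (x - u \<in> P) * of_bool (y - u \<in> P)))"

text \<open>Walks of length three are counted by their middle edge \<open>x y\<close> with weight
  \<open>d x * d y\<close>. On edges \<open>t\<close> is at most
  \<open>diff_count A (x - y)\<close>, and the enlarged form is a sum of squares.\<close>

lemma cherries_lower:
  assumes fin: "finite A" and symm: "\<And>x. - x \<in> P \<longleftrightarrow> x \<in> P"
    and pop: "\<And>p. p \<in> P \<Longrightarrow> t \<le> diff_count A p"
  shows "real t * (\<Sum>x\<in>A. \<Sum>y\<in>A. of_bool (x - y \<in> P)) ^ 3 \<le> 32 * real (card A) ^ 3 * cherries A P"
proof -
  let ?M = "\<lambda>x y. of_bool (x - y \<in> P) :: real"
  define d where "d x = (\<Sum>y\<in>A. ?M x y)" for x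
  define n where "n = real (card A)"
  have sym: "?M x y = ?M y x" for x y using symm[of "x - y"] by simp
  have d_nonneg: "d x \<ge> 0" for x unfolding d_def by (intro sum_nonneg) simp
  have "real t * (\<Sum>x\<in>A. \<Sum>y\<in>A. ?M x y * (d x * d y)) = (\<Sum>x\<in>A. \<Sum>y\<in>A. (real t * ?M x y) * (d x * d y))"
    by (simp only: sum_distrib_left mult.assoc)
  also have "\<dots> \<le> (\<Sum>x\<in>A. \<Sum>y\<in>A. real (diff_count A (x - y)) * (d x * d y))"
    using pop d_nonneg by (intro sum_mono mult_right_mono) auto
  also have "\<dots> = (\<Sum>c\<in>differences A. (\<Sum>x\<in>A. of_bool (x - c \<in> A) * d x) ^ 2)"
    by (rule diff_count_gram[OF fin, symmetric])
  \<comment> \<open>Each degree is expanded over the outer endpoint \<open>u\<close>, so that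
    Cauchy-Schwarz over \<open>u\<close> costs a factor \<open>n\<close>.\<close>
  also have "\<dots> = (\<Sum>c\<in>differences A. (\<Sum>u\<in>A. \<Sum>x\<in>A. of_bool (x - c \<in> A) * ?M x u) ^ 2)"
    unfolding d_def sum_distrib_left by (subst (2) sum.swap) (rule refl)
  also have "\<dots> \<le> (\<Sum>c\<in>differences A. n * (\<Sum>u\<in>A. (\<Sum>x\<in>A. of_bool (x - c \<in> A) * ?M x u) ^ 2))"
  proof (rule sum_mono)
    fix c
    show "(\<Sum>u\<in>A. \<Sum>x\<in>A. of_bool (x - c \<in> A) * ?M x u) ^ 2
      \<le> n * (\<Sum>u\<in>A. (\<Sum>x\<in>A. of_bool (x - c \<in> A) * ?M x u) ^ 2)"
      unfolding n_def mult.commute[of "real (card A)"] by (rule sum_squared_le_sum_of_squares)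
  qed
  also have "\<dots> = n * (\<Sum>u\<in>A. \<Sum>c\<in>differences A. (\<Sum>x\<in>A. of_bool (x - c \<in> A) * ?M x u) ^ 2)"
    unfolding sum_distrib_left[symmetric] by (subst sum.swap) (rule refl)
  \<comment> \<open>For each \<open>u\<close> the Gram identity is read backwards, now with the
    indicator of \<open>x - u \<in> P\<close> as weight.\<close>
  also have "\<dots> = n * cherries A P"
    unfolding cherries_def by (simp only: diff_count_gram[OF fin])
  finally have walks: "real t * (\<Sum>x\<in>A. \<Sum>y\<in>A. ?M x y * (d x * d y)) \<le> n * cherries A P" .
  have "real t * (\<Sum>x\<in>A. \<Sum>y\<in>A. ?M x y) ^ 3 \<le> real t * (32 * n ^ 2 * (\<Sum>x\<in>A. \<Sum>y\<in>A. ?M x y * (d x * d y)))"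
    unfolding d_def n_def by (intro mult_left_mono three_step_walks_lower fin) (simp_all add: sym del: of_bool_eq_iff)
  also have "\<dots> = 32 * n ^ 2 * (real t * (\<Sum>x\<in>A. \<Sum>y\<in>A. ?M x y * (d x * d y)))" by (simp only: mult_ac)
  also have "\<dots> \<le> 32 * n ^ 2 * (n * cherries A P)"
    using walks by (intro mult_left_mono) auto
  finally show ?thesis by (simp add: n_def power2_eq_square power3_eq_cube mult_ac)
qed

text \<open>Substituting \<open>x = u + p\<close> and \<open>y = u + q\<close> turns the weight into
  \<open>diff_count A (p - q)\<close>, independent of \<open>u\<close>. Cauchy-Schwarz over the
  pairs \<open>(p, q)\<close> then separates it from the number of admissible
  \<open>u\<close>.\<close>

lemma cherries_upper:
  assumes fin: "finite A" and P: "finite P"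
  shows "cherries A P ^ 2 \<le> (\<Sum>z\<in>differences A. real (diff_count A z) ^ 3)
    * (\<Sum>w\<in>P \<times> P. real (diff_count A (fst w - snd w)) ^ 2)"
proof -
  let ?b = "\<lambda>u p. of_bool (u + p \<in> A) :: real"
  let ?T = "\<lambda>w. \<Sum>u\<in>A. ?b u (fst w) * ?b u (snd w)"
  let ?r = "\<lambda>z. real (diff_count A z)"
  have "(\<Sum>x\<in>A. \<Sum>y\<in>A. ?r (x - y) * (of_bool (x - u \<in> P) * of_bool (y - u \<in> P)))
    = (\<Sum>w\<in>P \<times> P. ?b u (fst w) * ?b u (snd w) * ?r (fst w - snd w))" for u
  proof -
    have "(\<Sum>x\<in>A. \<Sum>y\<in>A. ?r (x - y) * (of_bool (x - u \<in> P) * of_bool (y - u \<in> P)))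
      = (\<Sum>x\<in>A. of_bool (x - u \<in> P) * (\<Sum>y\<in>A. of_bool (y - u \<in> P) * ?r (x - y)))"
      by (simp only: sum_distrib_left mult_ac)
    also have "\<dots> = (\<Sum>p\<in>P. ?b u p * (\<Sum>q\<in>P. ?b u q * ?r ((u + p) - (u + q))))"
      by (simp only: sum_translate[OF fin P])
    also have "\<dots> = (\<Sum>w\<in>P \<times> P. ?b u (fst w) * ?b u (snd w) * ?r (fst w - snd w))"
      by (simp only: sum_distrib_left sum.cartesian_product case_prod_unfold add_diff_cancel_left mult_ac)
    finally show ?thesis .
  qed
  then have "cherries A P = (\<Sum>u\<in>A. \<Sum>w\<in>P \<times> P. ?b u (fst w) * ?b u (snd w) * ?r (fst w - snd w))"
    unfolding cherries_def by simp
  also have "\<dots> = (\<Sum>w\<in>P \<times> P. ?T w * ?r (fst w - snd w))"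
    unfolding sum_distrib_right by (rule sum.swap)
  finally have "cherries A P ^ 2 \<le> (\<Sum>w\<in>P \<times> P. ?T w ^ 2) * (\<Sum>w\<in>P \<times> P. ?r (fst w - snd w) ^ 2)"
    by (simp only: Cauchy_Schwarz_ineq_sum)
  also have "(\<Sum>w\<in>P \<times> P. ?T w ^ 2) \<le> (\<Sum>z\<in>differences A. ?r z ^ 3)"
  proof -
    have inner: "(\<Sum>p\<in>P. ?b u p * ?b v p) \<le> ?r (u - v)" for u v
    proof -
      have "card {p \<in> P. u + p \<in> A \<and> v + p \<in> A} \<le> diff_count A (u - v)"
        unfolding diff_count_def
        by (rule card_inj_on_le[of "\<lambda>p. u + p"]) (use fin in \<open>auto simp: add.commute\<close>)
      then show ?thesis
        using card_Collect_eq_sum_of_bool[OF P, of "\<lambda>p. u + p \<in> A \<and> v + p \<in> A"]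
        by (simp only: of_bool_conj flip: of_nat_le_iff[where 'a = real])
    qed
    \<comment> \<open>Double counting: the square is expanded over \<open>u\<close> and
      \<open>v\<close>, and the sum over \<open>p\<close> and \<open>q\<close> factors into two
      equal sums, each at most \<open>?r (u - v)\<close>. Grouping by \<open>u - v\<close> supplies
      the third factor.\<close>
    have "(\<Sum>w\<in>P \<times> P. ?T w ^ 2) = (\<Sum>w\<in>P \<times> P. \<Sum>u\<in>A. \<Sum>v\<in>A. (?b u (fst w) * ?b v (fst w)) * (?b u (snd w) * ?b v (snd w)))"
      by (simp only: power2_eq_square sum_product mult_ac)
    also have "\<dots> = (\<Sum>u\<in>A. \<Sum>v\<in>A. \<Sum>w\<in>P \<times> P. (?b u (fst w) * ?b v (fst w)) * (?b u (snd w) * ?b v (snd w)))"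
      by (subst sum.swap, rule sum.cong[OF refl], rule sum.swap)
    also have "\<dots> = (\<Sum>u\<in>A. \<Sum>v\<in>A. (\<Sum>p\<in>P. ?b u p * ?b v p) ^ 2)"
      by (simp only: power2_eq_square sum_product sum.cartesian_product case_prod_unfold)
    also have "\<dots> \<le> (\<Sum>u\<in>A. \<Sum>v\<in>A. ?r (u - v) ^ 2)"
      by (intro sum_mono power_mono inner sum_nonneg) auto
    also have "\<dots> = (\<Sum>u\<in>A. \<Sum>v\<in>uminus ` A. ?r (u + v) ^ 2)"
      by (simp add: sum.reindex)
    also have "\<dots> = (\<Sum>z\<in>differences A. real (rep A (uminus ` A) z) * ?r z ^ 2)"
      by (rule sum_over_sumset) (use fin in auto)
    also have "\<dots> = (\<Sum>z\<in>differences A. ?r z ^ 3)"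
      by (simp only: diff_count_eq_rep power2_eq_square power3_eq_cube mult.assoc)
    finally show ?thesis .
  qed
  finally show ?thesis by (simp add: mult_right_mono sum_nonneg)
qed

section \<open>The number of popular differences\<close>

lemma popular_symmetric: "- x \<in> popular A t \<longleftrightarrow> x \<in> popular A t"
  by (simp add: popular_def diff_count_minus)

text \<open>Every popular difference is realised by at least \<open>t\<close> ordered pairs, each of
  which is an ordered edge.\<close>

lemma popular_degree_sum:
  assumes "finite A" "t \<ge> 1"
  shows "real t * card (popular A t) \<le> (\<Sum>x\<in>A. \<Sum>y\<in>A. of_bool (x - y \<in> popular A t))"
proof -
  define P where "P = popular A t"
  have finP: "finite P" using assms by (simp add: P_def popular_def finite_diff_count_ge)
  have dc: "(\<Sum>y\<in>A. of_bool (y + p \<in> A)) = real (diff_count A p)" for p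
    using card_Collect_eq_sum_of_bool[OF assms(1), of "\<lambda>a. a + p \<in> A"] diff_count_minus[of A p]
    unfolding diff_count_def by simp
  have "real t * card P = (\<Sum>p\<in>P. real t)" by simp
  also have "\<dots> \<le> (\<Sum>p\<in>P. \<Sum>y\<in>A. of_bool (y + p \<in> A))"
    unfolding dc by (intro sum_mono) (simp add: P_def popular_def)
  also have "\<dots> = (\<Sum>y\<in>A. \<Sum>p\<in>P. of_bool (y + p \<in> A) * 1)"
    unfolding mult_1_right by (rule sum.swap)
  also have "\<dots> = (\<Sum>y\<in>A. \<Sum>x\<in>A. of_bool (x - y \<in> P) * 1)"
    by (simp only: sum_translate[OF assms(1) finP, where f = "\<lambda>_. 1"])
  also have "\<dots> = (\<Sum>x\<in>A. \<Sum>y\<in>A. of_bool (x - y \<in> P))"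
    unfolding mult_1_right by (rule sum.swap)
  finally show ?thesis unfolding P_def .
qed

lemma card_popular_bound:
  assumes A: "finite_convex_set A" and t: "t \<ge> 1"
  shows "(real (card (popular A t)) * real t ^ 2) ^ 58
    \<le> 32 ^ 18 * 300 ^ 9 * (2 ^ 9 * 160000000000 ^ 2) * 100 ^ 12 * harm (card A) ^ 26 * real (card A) ^ 143"
proof (cases "card (popular A t) = 0")
  case False
  define P where "P = popular A t"
  define n H p \<tau> S Q where "n = real (card A)" and "H = (harm (card A) :: real)"
    and "p = real (card P)" and "\<tau> = real t" and "S = cherries A P"
    and "Q = (\<Sum>w\<in>P \<times> P. real (diff_count A (fst w - snd w)) ^ 2)"
  define c :: real where "c = 2 ^ 9 * 160000000000 ^ 2"
  have finA: "finite A" using A by (simp add: finite_convex_set_def)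
  have finP: "finite P" unfolding P_def popular_def by (intro finite_diff_count_ge finA t)
  have pos: "n \<ge> 0" "H \<ge> 0" "p > 0" "\<tau> > 0" "Q \<ge> 0" "c \<ge> 0"
    using False t by (auto simp: n_def H_def p_def \<tau>_def Q_def c_def P_def harm_nonneg intro: sum_nonneg)
  have "\<tau> * (\<tau> * p) ^ 3 \<le> \<tau> * (\<Sum>x\<in>A. \<Sum>y\<in>A. of_bool (x - y \<in> P)) ^ 3"
    unfolding \<tau>_def p_def P_def by (intro mult_left_mono power_mono popular_degree_sum finA t) auto
  also have "\<dots> \<le> 32 * n ^ 3 * S"
    unfolding \<tau>_def n_def S_def
    by (rule cherries_lower[OF finA]) (auto simp: P_def popular_symmetric, simp add: popular_def)
  finally have S_lower: "\<tau> ^ 4 * p ^ 3 \<le> 32 * n ^ 3 * S"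
    by (simp add: power_mult_distrib power3_eq_cube power4_eq_xxxx mult_ac)
  have "S ^ 2 \<le> (\<Sum>z\<in>differences A. real (diff_count A z) ^ 3) * Q"
    unfolding S_def Q_def by (rule cherries_upper[OF finA finP])
  also have "\<dots> \<le> 300 * H * n ^ 3 * Q"
    unfolding H_def n_def by (intro mult_right_mono third_moment_bound A) (use finA pos in auto)
  finally have S_upper: "S ^ 2 \<le> 300 * H * n ^ 3 * Q" .
  have Q_upper: "Q ^ 9 * \<tau> ^ 8 \<le> c * H ^ 17 * n ^ 26 * p ^ 8"
    unfolding Q_def \<tau>_def c_def H_def n_def p_def P_def by (rule popular_difference_second_moment[OF A t])
  \<comment> \<open>The powers 18 and 9 of the bounds on \<open>S\<close> eliminate it and leave
    exactly \<open>Q ^ 9 * \<tau> ^ 8\<close>, the left side of \<open>Q_upper\<close>.\<close>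
  have "(\<tau> ^ 80 * p ^ 46) * p ^ 8 = (\<tau> ^ 4 * p ^ 3) ^ 18 * \<tau> ^ 8"
    by (simp add: power_mult_distrib mult_ac flip: power_mult power_add)
  also have "\<dots> \<le> (32 * n ^ 3 * S) ^ 18 * \<tau> ^ 8"
    using S_lower pos by (intro mult_right_mono power_mono) auto
  also have "\<dots> = 32 ^ 18 * n ^ 54 * (S ^ 2) ^ 9 * \<tau> ^ 8"
    by (simp only: power_mult_distrib flip: power_mult) simp
  also have "\<dots> \<le> 32 ^ 18 * n ^ 54 * (300 * H * n ^ 3 * Q) ^ 9 * \<tau> ^ 8"
    using S_upper pos by (intro mult_right_mono mult_left_mono power_mono) auto
  also have "\<dots> = 32 ^ 18 * 300 ^ 9 * n ^ 81 * H ^ 9 * (Q ^ 9 * \<tau> ^ 8)"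
    by (simp add: power_mult_distrib mult_ac flip: power_mult power_add)
  also have "\<dots> \<le> 32 ^ 18 * 300 ^ 9 * n ^ 81 * H ^ 9 * (c * H ^ 17 * n ^ 26 * p ^ 8)"
    using Q_upper pos by (intro mult_left_mono) auto
  also have "\<dots> = (32 ^ 18 * 300 ^ 9 * c * H ^ 26 * n ^ 107) * p ^ 8"
    by (simp add: mult_ac flip: power_add)
  \<comment> \<open>Cancelling \<open>p ^ 8\<close> requires \<open>p > 0\<close>, hence the initial
    case distinction.\<close>
  finally have main: "\<tau> ^ 80 * p ^ 46 \<le> 32 ^ 18 * 300 ^ 9 * c * H ^ 26 * n ^ 107"
    using pos by (simp only: mult_le_cancel_right) simp
  have level: "p * \<tau> ^ 3 \<le> 100 * n ^ 3"
    unfolding p_def \<tau>_def n_def P_def popular_def by (rule card_diff_count_ge[OF A t])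
  \<comment> \<open>Twelve factors \<open>p * \<tau> ^ 3\<close> bring the exponents of
    \<open>\<tau>\<close> and \<open>p\<close> to 116 and 58, the ratio needed for a second
    moment.\<close>
  have "(p * \<tau> ^ 2) ^ 58 = (\<tau> ^ 80 * p ^ 46) * (p * \<tau> ^ 3) ^ 12"
    by (simp add: power_mult_distrib mult_ac flip: power_mult power_add)
  also have "\<dots> \<le> (32 ^ 18 * 300 ^ 9 * c * H ^ 26 * n ^ 107) * (100 * n ^ 3) ^ 12"
    by (rule mult_mono[OF main power_mono[OF level]]) (use pos in auto)
  also have "\<dots> = 32 ^ 18 * 300 ^ 9 * c * 100 ^ 12 * H ^ 26 * n ^ 143"
    by (simp add: power_mult_distrib mult_ac flip: power_mult power_add)
  finally show ?thesis unfolding p_def \<tau>_def P_def c_def H_def n_def .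
qed (simp add: harm_nonneg)

section \<open>Additive energy and the final exponent\<close>

text \<open>The equation \<open>a + b = c + d\<close> says \<open>b = d - (a - c)\<close>, so for
  fixed \<open>a\<close> and \<open>c\<close> the solutions number
  \<open>diff_count A (a - c)\<close>.\<close>

lemma additive_energy_eq_second_moment:
  assumes fin: "finite A"
  shows "real (additive_energy A) = (\<Sum>z\<in>differences A. real (diff_count A z) ^ 2)"
proof -
  have "additive_energy A = card (SIGMA w:A \<times> A. {d \<in> A. d - (fst w - snd w) \<in> A})"
    unfolding additive_energy_def
    by (rule bij_betw_same_card[of "\<lambda>(a, b, c, d). ((a, c), d)"],
        rule bij_betw_byWitness[where f' = "\<lambda>((a, c), d). (a, d - (a - c), c, d)"])
      (auto simp: algebra_simps, metis add_diff_cancel_left')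
  also have "\<dots> = (\<Sum>w\<in>A \<times> A. diff_count A (fst w - snd w))"
    using fin by (simp add: diff_count_def)
  finally have "real (additive_energy A) = (\<Sum>a\<in>A. \<Sum>c\<in>A. real (diff_count A (a - c)))"
    by (simp add: sum.cartesian_product case_prod_unfold)
  also have "\<dots> = (\<Sum>a\<in>A. \<Sum>c\<in>uminus ` A. real (diff_count A (a + c)))"
    by (simp add: sum.reindex)
  also have "\<dots> = (\<Sum>z\<in>differences A. real (rep A (uminus ` A) z) * real (diff_count A z))"
    by (rule sum_over_sumset) (use fin in auto)
  finally show ?thesis by (simp add: diff_count_eq_rep power2_eq_square)
qed

lemma additive_energy_power_bound:
  assumes A: "finite_convex_set A"
  shows "real (additive_energy A) ^ 58 \<le> 2 ^ 58 *
    (32 ^ 18 * 300 ^ 9 * (2 ^ 9 * 160000000000 ^ 2) * 100 ^ 12) * harm (card A) ^ 84 * real (card A) ^ 143"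
proof -
  define c :: real where "c = 32 ^ 18 * 300 ^ 9 * (2 ^ 9 * 160000000000 ^ 2) * 100 ^ 12"
  have finA: "finite A" using A by (simp add: finite_convex_set_def)
  have "real (additive_energy A) ^ 58 \<le> (real 2 * harm (card A)) ^ 58 * (c * harm (card A) ^ 26 * real (card A) ^ 143)"
    unfolding additive_energy_eq_second_moment[OF finA]
  proof (rule layer_cake_bound_power)
    fix t :: nat assume t: "1 \<le> t"
    have "card {x \<in> differences A. t \<le> diff_count A x} \<le> card (popular A t)"
      unfolding popular_def by (intro card_mono finite_diff_count_ge finA t) auto
    then have "(real (card {x \<in> differences A. t \<le> diff_count A x}) * real t ^ 2) ^ 58
      \<le> (real (card (popular A t)) * real t ^ 2) ^ 58"
      by (intro power_mono mult_right_mono) auto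
    also have "\<dots> \<le> c * harm (card A) ^ 26 * real (card A) ^ 143"
      unfolding c_def by (rule card_popular_bound[OF A t])
    finally show "(real (card {x \<in> differences A. t \<le> diff_count A x}) * real t ^ 2) ^ 58 \<le> \<dots>" .
  qed (use finA diff_count_le[OF finA] in \<open>auto simp: c_def harm_nonneg\<close>)
  also have "\<dots> = 2 ^ 58 * c * harm (card A) ^ 84 * real (card A) ^ 143"
    by (simp add: power_mult_distrib mult_ac flip: power_add)
  finally show ?thesis unfolding c_def .
qed

text \<open>The exponent makes the 84 harmonic factors of the energy bound cost
  \<open>n powr (7 / 18)\<close>, and \<open>143 + 7 / 18\<close> is exactly
  \<open>58 * 89 / 36\<close>. The constant is \<open>1 + 216\<close>, from
  \<open>1 + ln n\<close>.\<close>

lemma harm_le_powr: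
  assumes "n \<ge> 1"
  shows "harm n \<le> 217 * real n powr (1 / 216)"
proof -
  have "harm n \<le> 1 + ln (real n)"
    using assms
  proof (induction n rule: nat_induct_at_least)
    case (Suc n)
    have "ln (real n / real (Suc n)) \<le> real n / real (Suc n) - 1"
      using Suc by (intro ln_le_minus_one) auto
    also have "\<dots> = - inverse (real (Suc n))" by (simp add: field_simps)
    finally have "inverse (real (Suc n)) \<le> ln (real (Suc n)) - ln (real n)"
      using Suc by (simp add: ln_div)
    with Suc.IH show ?case by (simp add: harm_Suc)
  qed (simp add: harm_def)
  moreover have "ln (real n) = 216 * ln (real n powr (1 / 216))"
    using assms by (simp add: ln_powr)
  moreover have "ln (real n powr (1 / 216)) \<le> real n powr (1 / 216)"
    using assms by (intro ln_bound) auto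
  moreover have "1 \<le> real n powr (1 / 216)"
    using assms by (intro ge_one_powr_ge_zero) auto
  ultimately show ?thesis by linarith
qed

theorem theorem46:
  shows "\<exists>C > (0::real). \<forall>A :: real set. finite_convex_set A \<and> card A \<ge> 2 \<longrightarrow>
           real (additive_energy A)
             \<le> C * real (card A) powr (89 / 36) * (log 2 (real (card A))) powr (1 / 2)"
proof -
  define c :: real where "c = 32 ^ 18 * 300 ^ 9 * (2 ^ 9 * 160000000000 ^ 2) * 100 ^ 12"
  define C where "C = root 58 (2 ^ 58 * c * 217 ^ 84)"
  have c_pos: "c > 0" by (simp add: c_def)
  have C_pos: "C > 0" unfolding C_def using c_pos by (simp add: real_root_gt_zero)
  have C_pow: "C ^ 58 = 2 ^ 58 * c * 217 ^ 84" unfolding C_def using c_pos by (intro real_root_pow_pos2) auto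
  have "real (additive_energy A) \<le> C * real (card A) powr (89 / 36) * log 2 (real (card A)) powr (1 / 2)"
    if A: "finite_convex_set A" and A2: "card A \<ge> 2" for A
  proof -
    define n where "n = real (card A)"
    have n: "n \<ge> 2" using A2 by (simp add: n_def)
    have "real (additive_energy A) ^ 58 \<le> 2 ^ 58 * c * harm (card A) ^ 84 * n ^ 143"
      unfolding c_def n_def by (rule additive_energy_power_bound[OF A])
    also have "\<dots> \<le> 2 ^ 58 * c * (217 * n powr (1 / 216)) ^ 84 * n ^ 143"
      unfolding n_def using A2 c_pos
      by (intro mult_right_mono mult_left_mono power_mono harm_le_powr) (auto simp: harm_nonneg)
    also have "\<dots> = (C * n powr (89 / 36)) ^ 58"
    proof -
      have "(n powr (1 / 216)) ^ 84 * n ^ 143 = n powr (7 / 18) * n powr 143"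
        using n powr_power[of n "1 / 216" 84] powr_realpow[of n 143] by simp
      also have "\<dots> = n powr (2581 / 18)" by (simp flip: powr_add)
      also have "\<dots> = (n powr (89 / 36)) ^ 58"
        using n powr_power[of n "89 / 36" 58] by simp
      finally show ?thesis unfolding power_mult_distrib C_pow by simp
    qed
    finally have "real (additive_energy A) \<le> C * n powr (89 / 36)"
      using C_pos by (subst (asm) power_mono_iff) auto
    \<comment> \<open>Since \<open>n \<ge> 2\<close>, the logarithmic factor is at least one and
      inserting it only weakens the bound.\<close>
    also have "\<dots> \<le> C * n powr (89 / 36) * log 2 n powr (1 / 2)"
    proof -
      have "1 \<le> log 2 n" using n by simp
      then have "1 \<le> log 2 n powr (1 / 2)" by (intro ge_one_powr_ge_zero) auto
      then show ?thesis
        using C_pos mult_left_mono[of 1 "log 2 n powr (1 / 2)" "C * n powr (89 / 36)"] by simp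
    qed
    finally show ?thesis unfolding n_def .
  qed
  with C_pos show ?thesis by blast
qed

end
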